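(* Let $f\in\mathcal{A}$ be of the form $f(z)=z+a_2z^2+a_3z^3+\cdots$, and let $H_3(1)$ be its third Hankel determinant, $$H_3(1)=a_3(a_2a_4-a_3^2)-a_4(a_4-a_2a_3)+a_5(a_3-a_2^2).$$ Then: (i) If $f\in\mathcal{S}^\ast$, then $|H_3(1)|\le \frac{1}{18}(8+M)\approx 0.777987$, where $M=\max_{0\le x\le 1}\frac38x^2\left(21x^4-66x^2+16x+45\right)$. (ii) If $f\in\mathcal{S}^\ast_s$, then $|H_3(1)|\le \frac14+\frac{1}{3\sqrt3}$ $(=0.44245\ldots)$. (iii) If $f\in\mathcal{S}^\ast_e$, then $|H_3(1)|\le \frac{17}{72}$ $(=0.23611\ldots)$. (iv) If $f\in\mathcal{S}^\ast_q$, then $|H_3(1)|\le \frac{17}{72}$ $(=0.23611\ldots)$.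
   Context: Let $\mathbb{D}=\{z\in\mathbb{C}:|z|<1\}$ be the open unit disk. $\mathcal{A}$ denotes the class of functions $f$ analytic in $\mathbb{D}$ and normalized by $f(0)=0$, $f'(0)=1$, i.e. $f(z)=z+a_2z^2+a_3z^3+\cdots$. The third Hankel determinant of $f$ is $$H_3(1)=\det\begin{pmatrix}1&a_2&a_3\\ a_2&a_3&a_4\\ a_3&a_4&a_5\end{pmatrix}=a_3(a_2a_4-a_3^2)-a_4(a_4-a_2a_3)+a_5(a_3-a_2^2).$$ Subordination: for functions $F,G$ analytic in $\mathbb{D}$, $F\prec G$ means that there is a Schwarz function $\omega$ (that is, $\omega$ is analytic in $\mathbb{D}$ with $\omega(0)=0$ and $|\omega(z)|<1$ for all $z\in\mathbb{D}$) such that $F(z)=G(\omega(z))$ for all $z\in\mathbb{D}$. The classes are (quotients being understood as analytic functions on $\mathbb{D}$, with value $1$ at $z=0$ by removing the singularity): $$\mathcal{S}^\ast=\left\{f\in\mathcal{A}:\frac{zf'(z)}{f(z)}\prec\frac{1+z}{1-z}\right\}\quad\text{(starlike functions)},$$ $$\mathcal{S}^\ast_s=\left\{f\in\mathcal{A}:\frac{2zf'(z)}{f(z)-f(-z)}\prec\frac{1+z}{1-z}\right\}\quad\text{(functions starlike with respect to symmetric points)},$$ $$\mathcal{S}^\ast_e=\left\{f\in\mathcal{A}:\frac{zf'(z)}{f(z)}\prec e^z\right\},$$ $$\mathcal{S}^\ast_q=\left\{f\in\mathcal{A}:\frac{zf'(z)}{f(z)}\prec z+\sqrt{1+z^2}\right\},$$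 where the square root is the principal branch (equal to $1$ at $z=0$). *)

theory Defs
  imports "HOL-Complex_Analysis.Complex_Analysis"
begin

abbreviation unit_disk :: "complex set" where
  "unit_disk \<equiv> ball 0 1"

definition class_A :: "(complex \<Rightarrow> complex) set" where
  "class_A = {f. f holomorphic_on unit_disk \<and> f 0 = 0 \<and> deriv f 0 = 1}"

definition taylor_coeff :: "(complex \<Rightarrow> complex) \<Rightarrow> nat \<Rightarrow> complex" where
  "taylor_coeff f n = fps_nth (fps_expansion f 0) n"

definition third_hankel_det :: "(complex \<Rightarrow> complex) \<Rightarrow> complex" where
  "third_hankel_det f =
     (let a = taylor_coeff f in
      det (vector [vector [1,   a 2, a 3],
                   vector [a 2, a 3, a 4],
                   vector [a 3, a 4, a 5]] :: complex ^ 3 ^ 3))"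

lemma third_hankel_det_expand:
  assumes "\<And>n. a n = taylor_coeff f n"
  shows "third_hankel_det f =
           a 3 * (a 2 * a 4 - a 3 ^ 2) - a 4 * (a 4 - a 2 * a 3) + a 5 * (a 3 - a 2 ^ 2)"
  unfolding third_hankel_det_def Let_def assms det_3
  by (simp add: algebra_simps power2_eq_square)

definition schwarz_function :: "(complex \<Rightarrow> complex) \<Rightarrow> bool" where
  "schwarz_function \<omega> \<longleftrightarrow>
     \<omega> holomorphic_on unit_disk \<and> \<omega> 0 = 0 \<and> (\<forall>z\<in>unit_disk. norm (\<omega> z) < 1)"

definition subordinate :: "(complex \<Rightarrow> complex) \<Rightarrow> (complex \<Rightarrow> complex) \<Rightarrow> bool"
    (infix "\<prec>\<^sub>s" 50) where
  "F \<prec>\<^sub>s G \<longleftrightarrow>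
     F holomorphic_on unit_disk \<and> G holomorphic_on unit_disk \<and>
     (\<exists>\<omega>. schwarz_function \<omega> \<and> (\<forall>z\<in>unit_disk. F z = G (\<omega> z)))"

(* remove_sings fills in the removable singularity at 0.  It sends a pole to 0, as does
   division by zero, but there the resulting function is not continuous, so that the
   holomorphy requirement in subordination excludes quotients with a pole in the disk. *)
definition starlike_quotient :: "(complex \<Rightarrow> complex) \<Rightarrow> complex \<Rightarrow> complex" where
  "starlike_quotient f = remove_sings (\<lambda>z. z * deriv f z / f z)"

definition sym_starlike_quotient :: "(complex \<Rightarrow> complex) \<Rightarrow> complex \<Rightarrow> complex" where
  "sym_starlike_quotient f = remove_sings (\<lambda>z. 2 * z * deriv f z / (f z - f (- z)))"

lemma quotient_tendsto_1:
  assumes g: "(g has_field_derivative d) (at 0)" "g 0 = 0" "d \<noteq> 0"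
    and f: "f \<in> class_A"
  shows "(\<lambda>z. d * z * deriv f z / g z) \<midarrow>0\<rightarrow> 1"
proof -
  have "(\<lambda>z. g z / z) \<midarrow>0\<rightarrow> d"
    using g by (simp add: has_field_derivative_iff)
  moreover have "deriv f holomorphic_on unit_disk"
    using f by (intro holomorphic_deriv) (auto simp: class_A_def)
  then have "isCont (deriv f) 0"
    using holomorphic_on_imp_continuous_on continuous_on_eq_continuous_at[of unit_disk]
    by fastforce
  then have "deriv f \<midarrow>0\<rightarrow> 1"
    using f by (simp add: isCont_def class_A_def)
  ultimately have "(\<lambda>z. d * deriv f z / (g z / z)) \<midarrow>0\<rightarrow> d * 1 / d"
    using g by (intro tendsto_intros)
  then show ?thesis
    using g by (simp add: mult_ac)
qed

lemma class_A_has_deriv: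
  assumes "f \<in> class_A"
  shows "(f has_field_derivative 1) (at 0)"
  using assms holomorphic_derivI[of f unit_disk 0] by (auto simp: class_A_def)

lemma starlike_quotient_0:
  assumes "f \<in> class_A"
  shows "starlike_quotient f 0 = 1"
  unfolding starlike_quotient_def
  using quotient_tendsto_1[OF class_A_has_deriv[OF assms] _ _ assms] assms
  by (intro remove_sings_eqI) (auto simp: class_A_def)

lemma sym_starlike_quotient_0:
  assumes "f \<in> class_A"
  shows "sym_starlike_quotient f 0 = 1"
proof -
  have "(f has_field_derivative 1) (at (- 0))"
    using class_A_has_deriv[OF assms] by simp
  then have "((\<lambda>z. f (- z)) has_field_derivative - 1) (at 0)"
    using DERIV_chain2[OF _ DERIV_minus[OF DERIV_ident]] by fastforce
  then have "((\<lambda>z. f z - f (- z)) has_field_derivative 2) (at 0)"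
    using DERIV_diff[OF class_A_has_deriv[OF assms]] by fastforce
  from quotient_tendsto_1[OF this _ _ assms] show ?thesis
    unfolding sym_starlike_quotient_def by (intro remove_sings_eqI) auto
qed

definition starlike_class :: "(complex \<Rightarrow> complex) set" where
  "starlike_class = {f \<in> class_A. starlike_quotient f \<prec>\<^sub>s (\<lambda>z. (1 + z) / (1 - z))}"

definition sym_starlike_class :: "(complex \<Rightarrow> complex) set" where
  "sym_starlike_class = {f \<in> class_A. sym_starlike_quotient f \<prec>\<^sub>s (\<lambda>z. (1 + z) / (1 - z))}"

definition exp_starlike_class :: "(complex \<Rightarrow> complex) set" where
  "exp_starlike_class = {f \<in> class_A. starlike_quotient f \<prec>\<^sub>s exp}"

definition lune_starlike_class :: "(complex \<Rightarrow> complex) set" where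
  "lune_starlike_class = {f \<in> class_A. starlike_quotient f \<prec>\<^sub>s (\<lambda>z. z + csqrt (1 + z ^ 2))}"

definition bound_poly :: "real \<Rightarrow> real" where
  "bound_poly x = 3 / 8 * x ^ 2 * (21 * x ^ 4 - 66 * x ^ 2 + 16 * x + 45)"

(* Max is only for finite sets; the supremum over the compact interval is attained. *)
definition bound_max :: real where
  "bound_max = (SUP x\<in>{0..1}. bound_poly x)"

lemma bound_max_is_maximum:
  "\<exists>x\<in>{0..1}. bound_poly x = bound_max \<and> (\<forall>y\<in>{0..1}. bound_poly y \<le> bound_max)"
proof -
  have "continuous_on {0..1} bound_poly"
    unfolding bound_poly_def by (intro continuous_intros)
  then obtain x where x: "x \<in> {0..1}" "\<forall>y\<in>{0..1}. bound_poly y \<le> bound_poly x"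
    using continuous_attains_sup[of "{0..1::real}" bound_poly] by auto
  then have "bound_max = bound_poly x"
    unfolding bound_max_def by (intro cSup_eq_maximum) auto
  with x show ?thesis by metis
qed

end

theory Submission
  imports Defs
begin

text \<open>Let \<open>c1, c2, c3, c4\<close> be the first coefficients of the Schwarz function that realises the
subordination. In each of the four classes the Taylor coefficients \<open>a2, ..., a5\<close> of \<open>f\<close> are
polynomials in them, and the third Hankel determinant becomes a combination of the eight monomials
\<open>c1^6, c1^4 c2, c1^3 c3, c1^2 c2^2, c1^2 c4, c1 c2 c3, c2 c4, c3^2\<close>. (The weight of every
monomial is 6, and \<open>c2^3\<close> cancels.) Only the last two are free of \<open>c1\<close>.

Since the Schwarz function is bounded by 1, Bessel's inequality
\<open>|c1|^2 + |c2|^2 + |c3|^2 + |c4|^2 \<le> 1\<close> holds (\<open>bessel_inequality_disk\<close>). It bounds the sum of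
the last two terms by \<open>K (1 - |c1|^2)\<close>, where \<open>K\<close> is the larger of the size of the coefficient of
\<open>c3^2\<close> and half that of \<open>c2 c4\<close>, and it makes the other terms small: each of them contains \<open>c1\<close>,
so that it competes with the leading ones for the same unit of mass. The outcome
(\<open>norm_hankel_form_le\<close>) is a concave quadratic polynomial in \<open>s = |c1|^2\<close>, whose values stay below
\<open>37/48\<close> for starlike functions, \<open>3/8\<close> for functions starlike with respect to symmetric points,
and \<open>17/72\<close> for the exponential and the lune class. These constants are at most the claimed
bounds; for the first class this rests on the numerical value of the maximum \<open>M\<close>, which is
located by \<open>bound_max_approx\<close>.

The dependence of \<open>a2, ..., a5\<close> on \<open>c1, ..., c4\<close> comes from formal power series. Clearing the
denominator of \<open>z f'/f\<close> gives a recursion for the coefficients of \<open>f\<close>, and every subordinating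
function satisfies a simple functional or differential equation, from which the coefficients of the
quotient can be read off without composing series.\<close>

unbundle no vec_syntax

section \<open>Bessel's inequality for holomorphic functions on a disk\<close>

text \<open>On the circle of radius \<open>r\<close> one has \<open>cnj z = r^2 / z\<close>, so this mean value is Cauchy's integral
formula for the \<open>k\<close>-th Taylor coefficient.\<close>
lemma circle_mean_times_cnj_power:
  fixes f :: "complex \<Rightarrow> complex"
  assumes holf: "f holomorphic_on ball 0 R" and r: "0 < r" "r < R"
  shows "((\<lambda>t. f (circlepath 0 r t) * cnj (circlepath 0 r t) ^ k) has_integral
           of_real (r ^ (2 * k)) * fps_nth (fps_expansion f 0) k) {0..1}"
proof -
  define a where "a = (deriv ^^ k) f 0 / fact k"
  have circ: "circlepath 0 r t = of_real r * exp (2 * of_real pi * \<i> * of_real t)" for t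
    by (simp add: circlepath)
  have "cball 0 r \<subseteq> ball 0 R" using r by auto
  then have "continuous_on (cball 0 r) f" "f holomorphic_on ball 0 r"
    using holf r by (auto intro: holomorphic_on_subset holomorphic_on_imp_continuous_on)
  from Cauchy_has_contour_integral_higher_derivative_circlepath[OF this, of 0 k]
  have "((\<lambda>u. f u / u ^ Suc k) has_contour_integral (2 * pi * \<i> * a)) (circlepath 0 r)"
    using r by (simp add: a_def)
  then have "((\<lambda>t. f (circlepath 0 r t) / circlepath 0 r t ^ Suc k *
        (2 * pi * \<i> * circlepath 0 r t)) has_integral (2 * pi * \<i> * a)) {0..1}"
    by (simp add: has_contour_integral vector_derivative_circlepath circ mult_ac)
  from has_integral_mult_right[OF this, of "of_real (r ^ (2 * k)) / (2 * pi * \<i>)"]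
  have "((\<lambda>t. of_real (r ^ (2 * k)) / (2 * pi * \<i>) * (f (circlepath 0 r t) /
        circlepath 0 r t ^ Suc k * (2 * pi * \<i> * circlepath 0 r t))) has_integral
        of_real (r ^ (2 * k)) / (2 * pi * \<i>) * (2 * pi * \<i> * a)) {0..1}" .
  moreover have "of_real (r ^ (2 * k)) / (2 * pi * \<i>) * (f z / z ^ Suc k * (2 * pi * \<i> * z))
      = f z * cnj z ^ k" if "norm z = r" for z
  proof -
    have "z \<noteq> 0" using that r by auto
    moreover have "of_real (r ^ (2 * k)) = (z * cnj z) ^ k"
      using that by (simp add: complex_norm_square[symmetric] power_mult)
    ultimately show ?thesis by (simp add: field_simps power_mult_distrib)
  qed
  moreover have "norm (circlepath 0 r t) = r" for t
    using r by (simp add: circ norm_mult)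
  moreover have "of_real (r ^ (2 * k)) / (2 * pi * \<i>) * (2 * pi * \<i> * a)
      = of_real (r ^ (2 * k)) * fps_nth (fps_expansion f 0) k"
    by (simp add: field_simps a_def fps_expansion_def)
  ultimately show ?thesis by (simp only:)
qed

text \<open>With \<open>P\<close> the Taylor polynomial of degree \<open>n\<close>, the means of \<open>f cnj(P)\<close> and of \<open>P cnj(P)\<close> over the
circle are the same number \<open>S\<close>, because by the preceding lemma they involve only the coefficients up
to \<open>n\<close>. Taking the mean of \<open>2 Re (f cnj(P)) - |P|^2 \<le> |f|^2 \<le> B^2\<close> leaves \<open>S \<le> B^2\<close>.\<close>
lemma bessel_inequality_circle:
  fixes f :: "complex \<Rightarrow> complex"
  assumes holf: "f holomorphic_on ball 0 R" and r: "0 < r" "r < R"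
    and bound: "\<And>z. z \<in> ball 0 R \<Longrightarrow> norm (f z) \<le> B"
  shows "(\<Sum>k\<le>n. r ^ (2 * k) * (norm (fps_nth (fps_expansion f 0) k))\<^sup>2) \<le> B\<^sup>2"
proof -
  define a where "a k = fps_nth (fps_expansion f 0) k" for k
  define P where "P z = (\<Sum>k\<le>n. a k * z ^ k)" for z
  define c where "c = circlepath 0 r"
  define S where "S = (\<Sum>k\<le>n. r ^ (2 * k) * (norm (a k))\<^sup>2)"
  have expP: "P has_fps_expansion (\<Sum>k\<le>n. fps_const (a k) * fps_X ^ k)"
    unfolding P_def by (intro fps_expansion_intros)
  then have coeffP: "fps_nth (fps_expansion P 0) k = a k" if "k \<le> n" for k
    using that by (simp add: fps_expansion_eqI[OF expP] fps_sum_nth fps_X_power_nth if_distrib cong: if_cong)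
  have against_P: "((\<lambda>t. Re (g (c t) * cnj (P (c t)))) has_integral S) {0..1}"
    if "g holomorphic_on ball 0 R" "\<And>k. k \<le> n \<Longrightarrow> fps_nth (fps_expansion g 0) k = a k" for g
  proof -
    have "((\<lambda>t. \<Sum>k\<le>n. cnj (a k) * (g (c t) * cnj (c t) ^ k)) has_integral
            (\<Sum>k\<le>n. cnj (a k) * (of_real (r ^ (2 * k)) * a k))) {0..1}"
      unfolding c_def
    proof (intro has_integral_sum has_integral_mult_right finite_atMost)
      fix k assume "k \<in> {..n}"
      then show "((\<lambda>t. g (circlepath 0 r t) * cnj (circlepath 0 r t) ^ k) has_integral
          of_real (r ^ (2 * k)) * a k) {0..1}"
        using circle_mean_times_cnj_power[OF that(1) r, of k] that(2)[of k] by simp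
    qed
    moreover have "(\<Sum>k\<le>n. cnj (a k) * (of_real (r ^ (2 * k)) * a k)) = of_real S"
      by (simp add: S_def complex_norm_square mult_ac del: of_real_power)
    moreover have "(\<Sum>k\<le>n. cnj (a k) * (g (c t) * cnj (c t) ^ k)) = g (c t) * cnj (P (c t))" for t
      by (simp add: P_def sum_distrib_left mult_ac)
    ultimately have "((\<lambda>t. g (c t) * cnj (P (c t))) has_integral of_real S) {0..1}"
      by (simp only:)
    from has_integral_Re[OF this] show ?thesis by simp
  qed
  have "P holomorphic_on ball 0 R"
    unfolding P_def by (intro holomorphic_intros)
  from has_integral_diff[OF has_integral_mult_right[OF against_P[OF holf], of 2]
      against_P[OF this coeffP]]
  have "((\<lambda>t. 2 * Re (f (c t) * cnj (P (c t))) - Re (P (c t) * cnj (P (c t)))) has_integral S) {0..1}"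
    by (simp add: a_def)
  moreover have "((\<lambda>t. B\<^sup>2) has_integral B\<^sup>2) {0..1::real}"
    using has_integral_const_real[of "B\<^sup>2" 0 1] by simp
  moreover have "2 * Re (f (c t) * cnj (P (c t))) - Re (P (c t) * cnj (P (c t))) \<le> B\<^sup>2" for t
  proof -
    have "c t \<in> ball 0 R"
      using r by (simp add: c_def circlepath norm_mult)
    then have "(norm (f (c t)))\<^sup>2 \<le> B\<^sup>2"
      using bound by (intro power_mono) auto
    moreover have "0 \<le> (norm (f (c t) - P (c t)))\<^sup>2"
      by simp
    ultimately show ?thesis
      unfolding cmod_power2 by (simp add: power2_eq_square algebra_simps)
  qed
  ultimately have "S \<le> B\<^sup>2"
    by (rule has_integral_le)
  then show ?thesis by (simp add: S_def a_def)
qed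

text \<open>Let the radius tend to 1 in the inequality on circles.\<close>
theorem bessel_inequality_disk:
  fixes f :: "complex \<Rightarrow> complex"
  assumes holf: "f holomorphic_on ball 0 1"
    and bound: "\<And>z. z \<in> ball 0 1 \<Longrightarrow> norm (f z) \<le> B"
  shows "(\<Sum>k\<le>n. (norm (fps_nth (fps_expansion f 0) k))\<^sup>2) \<le> B\<^sup>2"
proof -
  let ?S = "\<lambda>r. \<Sum>k\<le>n. r ^ (2 * k) * (norm (fps_nth (fps_expansion f 0) k))\<^sup>2"
  have "(?S \<longlongrightarrow> ?S 1) (at_left 1)"
    by (intro tendsto_intros)
  moreover have "\<forall>\<^sub>F r in at_left 1. ?S r \<le> B\<^sup>2"
    using bessel_inequality_circle[OF holf _ _ bound]
    by (intro eventually_at_leftI[of 0]) auto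
  ultimately have "?S 1 \<le> B\<^sup>2"
    by (intro tendsto_upperbound) auto
  then show ?thesis by simp
qed

section \<open>The Hankel determinant as a form in the Schwarz coefficients\<close>

text \<open>The shape of the form is the one that the Hankel determinant takes in all four classes. Every estimate
is \<open>2 u v \<le> u^2 + v^2\<close> followed by Bessel's inequality. The terms with \<open>c2 c4\<close> and \<open>c3^2\<close> are
estimated together, and so are those with \<open>c1^2 c2^2\<close> and \<open>c1^2 c4\<close>: in both cases the two terms use
disjoint parts of the mass \<open>1 - s\<close>, and separate bounds would count it twice. For \<open>c1^2 c4\<close> the
inequality \<open>2 |c4| \<le> 1 + |c4|^2\<close> is used, which explains the hypothesis on \<open>L\<close>. For \<open>c1 c2 c3\<close> the
bound \<open>2 |c1| \<le> 1 + s\<close> keeps the result a polynomial in \<open>s\<close>.\<close>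
lemma norm_hankel_form_le:
  fixes c1 c2 c3 c4 ka kb kc kd ke kf kg kh :: complex
  assumes sq: "(norm c1)\<^sup>2 + (norm c2)\<^sup>2 + (norm c3)\<^sup>2 + (norm c4)\<^sup>2 \<le> 1"
    and K: "norm kg \<le> 2 * K" "norm kh \<le> K"
    and L: "norm kd \<le> L" "norm ke \<le> 2 * L"
    and s: "s = (norm c1)\<^sup>2"
  shows "norm (ka * c1^6 + kb * c1^4 * c2 + kc * c1^3 * c3 + kd * c1\<^sup>2 * c2\<^sup>2 + ke * c1\<^sup>2 * c4
              + kf * c1 * c2 * c3 + kg * c2 * c4 + kh * c3\<^sup>2)
       \<le> K * (1 - s) + L * s * (1 - s) + norm kf * (1 - s\<^sup>2) / 4
          + (norm ka + (norm kb + norm kc + norm ke) / 2) * s"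
    (is "norm ?H \<le> _")
proof -
  define x where "x = norm c1"
  define y where "y = norm c2"
  define z where "z = norm c3"
  define w where "w = norm c4"
  have nonneg: "0 \<le> x" "0 \<le> y" "0 \<le> z" "0 \<le> w"
    by (simp_all add: x_def y_def z_def w_def)
  have sum1: "s + y\<^sup>2 + z\<^sup>2 + w\<^sup>2 \<le> 1" and sx: "s = x\<^sup>2"
    using sq s by (simp_all add: x_def y_def z_def w_def)
  have amgm: "2 * (u * v) \<le> u\<^sup>2 + v\<^sup>2" for u v :: real
    using zero_le_power2[of "u - v"] by (simp add: power2_diff)
  have s01: "0 \<le> s" "s \<le> 1"
    using sum1 sx zero_le_power2[of x] zero_le_power2[of y] zero_le_power2[of z] zero_le_power2[of w]
    by linarith+
  have "x \<le> 1" using s01(2) unfolding sx by (intro power2_le_imp_le[of x 1]) auto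
  have nn: "0 \<le> K" "0 \<le> L"
    using K(2) L(1) norm_ge_zero[of kh] norm_ge_zero[of kd] by linarith+
  have xy: "x * y \<le> 1 / 2" and xz: "x * z \<le> 1 / 2" and yz: "2 * (y * z) \<le> 1 - s"
    using amgm[of x y] amgm[of x z] amgm[of y z] sum1 sx
      zero_le_power2[of y] zero_le_power2[of z] zero_le_power2[of w] by linarith+
  have t1: "x ^ 6 \<le> s"
    using power_decreasing[of 2 6 x] \<open>x \<le> 1\<close> nonneg sx by simp
  have t2: "x ^ 4 * y \<le> s / 2"
  proof -
    have "x ^ 4 * y = s * x * (x * y)" by (simp add: sx power_numeral_reduce)
    also have "\<dots> \<le> s * 1 * (1 / 2)"
      using xy s01 \<open>x \<le> 1\<close> nonneg by (intro mult_mono) auto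
    finally show ?thesis by simp
  qed
  have t3: "x ^ 3 * z \<le> s / 2"
  proof -
    have "x ^ 3 * z = s * (x * z)" by (simp add: sx power_numeral_reduce)
    also have "\<dots> \<le> s * (1 / 2)"
      using xz s01 by (intro mult_left_mono) auto
    finally show ?thesis by simp
  qed
  have t6: "x * y * z \<le> (1 - s\<^sup>2) / 4"
  proof -
    have "x * (y * z) \<le> (1 + s) / 2 * ((1 - s) / 2)"
      using amgm[of x 1] yz sx s01 nonneg by (intro mult_mono) auto
    then show ?thesis by (simp add: algebra_simps power2_eq_square)
  qed
  have t45: "norm kd * (s * y\<^sup>2) + norm ke * (s * w) \<le> L * s * (1 - s) + norm ke / 2 * s"
  proof -
    have "norm kd * (s * y\<^sup>2) \<le> L * (s * y\<^sup>2)"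
      using L s01 by (intro mult_right_mono) auto
    moreover have "norm ke * (s * w) \<le> norm ke / 2 * s + L * (s * w\<^sup>2)"
    proof -
      have "norm ke * (s * w) \<le> norm ke * (s * ((1 + w\<^sup>2) / 2))"
        using amgm[of 1 w] s01 by (intro mult_left_mono) auto
      also have "\<dots> = norm ke / 2 * s + norm ke / 2 * (s * w\<^sup>2)"
        by (simp add: field_simps)
      also have "norm ke / 2 * (s * w\<^sup>2) \<le> L * (s * w\<^sup>2)"
        using L s01 by (intro mult_right_mono) auto
      finally show ?thesis by simp
    qed
    moreover have "L * (s * (y\<^sup>2 + w\<^sup>2)) \<le> L * (s * (1 - s))"
    proof (intro mult_left_mono)
      show "y\<^sup>2 + w\<^sup>2 \<le> 1 - s" using sum1 zero_le_power2[of z] by linarith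
    qed (use nn s01 in auto)
    ultimately show ?thesis by (simp add: algebra_simps)
  qed
  have t78: "norm kg * (y * w) + norm kh * z\<^sup>2 \<le> K * (1 - s)"
  proof -
    have "norm kg * (y * w) \<le> 2 * K * ((y\<^sup>2 + w\<^sup>2) / 2)"
      using amgm[of y w] K nonneg nn by (intro mult_mono) auto
    moreover have "norm kh * z\<^sup>2 \<le> K * z\<^sup>2"
      using K by (intro mult_right_mono) auto
    moreover have "K * (y\<^sup>2 + z\<^sup>2 + w\<^sup>2) \<le> K * (1 - s)"
      using nn sum1 by (intro mult_left_mono) auto
    ultimately show ?thesis by (simp add: algebra_simps)
  qed
  have "norm ?H \<le> norm (ka * c1^6) + norm (kb * c1^4 * c2) + norm (kc * c1^3 * c3)
      + norm (kd * c1\<^sup>2 * c2\<^sup>2) + norm (ke * c1\<^sup>2 * c4) + norm (kf * c1 * c2 * c3)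
      + norm (kg * c2 * c4) + norm (kh * c3\<^sup>2)"
    by (intro norm_triangle_mono order_refl)
  also have "\<dots> = norm ka * x^6 + norm kb * (x^4 * y) + norm kc * (x^3 * z)
      + (norm kd * (s * y\<^sup>2) + norm ke * (s * w)) + norm kf * (x * y * z)
      + (norm kg * (y * w) + norm kh * z\<^sup>2)"
    by (simp add: norm_mult norm_power x_def y_def z_def w_def s mult_ac)
  also have "\<dots> \<le> norm ka * s + norm kb * (s / 2) + norm kc * (s / 2)
      + (L * s * (1 - s) + norm ke / 2 * s) + norm kf * ((1 - s\<^sup>2) / 4) + K * (1 - s)"
    using mult_left_mono[OF t1, of "norm ka"] mult_left_mono[OF t2, of "norm kb"]
      mult_left_mono[OF t3, of "norm kc"] mult_left_mono[OF t6, of "norm kf"] t45 t78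
    by simp
  finally show ?thesis
    by (simp add: algebra_simps add_divide_distrib)
qed

section \<open>The numerical values of the bounds\<close>

text \<open>The maximum is attained near \<open>0.94854\<close>. Dividing \<open>6.003775 - bound_poly x\<close> twice by \<open>x - 0.94854\<close>
gives a linear remainder, which is positive on the interval because \<open>e\<close> is tiny, and the quotient
\<open>q\<close>, which is positive there. The constants are the exact results of this division.\<close>
lemma bound_poly_le:
  assumes "0 \<le> x" "x \<le> 1"
  shows "bound_poly x \<le> 6.003775"
proof -
  define a :: real where "a = 66728495338481900817 / 10000000000000000000"
  define b :: real where "b = 3517436039660571 / 250000000000000"
  define c :: real where "c = 69878457819 / 20000000000"
  define d :: real where "d = 1263742518587224239808793 / 125000000000000000000000000000"
  define e :: real where "e = 19037840639669856423 / 1250000000000000000000000"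
  define q where "q = a + b * x + c * x^2 - 2987901 / 200000 * x^3 - 63 / 8 * x^4"
  have id: "6.003775 - bound_poly x = d - e * (x - 0.94854) + (x - 0.94854)^2 * q"
    unfolding bound_poly_def a_def b_def c_def d_def e_def q_def
    by (simp add: field_simps power_numeral_reduce)
  have "x^2 \<le> 1" "x^3 \<le> x" "x^4 \<le> x\<^sup>2"
    using assms power_decreasing[of 1 3 x] power_decreasing[of 2 4 x] by (auto simp: power_le_one)
  \<comment> \<open>Replacing \<open>x^3\<close> by \<open>x\<close> and \<open>x^4\<close> by \<open>x^2\<close> leaves a quadratic whose constant term
    outweighs its two negative coefficients.\<close>
  then have "0 \<le> q" using assms
    unfolding q_def a_def b_def c_def by (simp add: field_simps)
  moreover have "0 \<le> d - e * (x - 0.94854)"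
    using assms by (simp add: d_def e_def field_simps)
  ultimately have "0 \<le> 6.003775 - bound_poly x"
    unfolding id by (intro add_nonneg_nonneg mult_nonneg_nonneg) auto
  then show ?thesis by simp
qed

lemma bound_max_approx: "\<bar>1 / 18 * (8 + bound_max) - 0.777987\<bar> \<le> 0.0000005"
proof -
  obtain x where x: "x \<in> {0..1}" "bound_poly x = bound_max" "\<forall>y\<in>{0..1}. bound_poly y \<le> bound_max"
    using bound_max_is_maximum by blast
  have "bound_poly 0.9485 \<le> bound_max"
    using x by simp
  moreover have "6.00376 \<le> bound_poly 0.9485"
    by (simp add: bound_poly_def field_simps power_numeral_reduce)
  moreover have "bound_max \<le> 6.003775"
    using x bound_poly_le[of x] by simp
  ultimately show ?thesis by (simp add: abs_le_iff field_simps)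
qed

lemma sqrt3_numeric: "1 / 4 + 1 / (3 * sqrt 3) \<in> {0.44245..<0.44246::real}"
proof -
  have "1.73205 \<le> sqrt 3" "sqrt 3 \<le> 1.73206"
    by (rule real_le_rsqrt real_le_lsqrt; simp add: power2_eq_square)+
  moreover have "1 / (3 * sqrt 3) = sqrt 3 / 9"
    by (simp add: field_simps)
  ultimately show ?thesis by simp
qed

section \<open>From the quotients to formal power series\<close>

lemma has_fps_expansion_disk:
  "f holomorphic_on unit_disk \<Longrightarrow> f has_fps_expansion fps_expansion f 0"
  by (rule has_fps_expansion_fps_expansion[of unit_disk]) auto

lemma fps_eq_of_disk_identity:
  fixes f g :: "complex \<Rightarrow> complex"
  assumes "f has_fps_expansion F" "g has_fps_expansion G"
    and "\<And>z. z \<in> unit_disk \<Longrightarrow> f z = g z"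
  shows "F = G"
proof -
  have "\<forall>\<^sub>F z in nhds 0. z \<in> unit_disk"
    by (intro eventually_nhds_in_open) auto
  then have "\<forall>\<^sub>F z in nhds 0. f z = g z"
    by eventually_elim (use assms(3) in auto)
  with assms(1) have "g has_fps_expansion F"
    using has_fps_expansion_cong[OF _ refl] by blast
  with assms(2) show ?thesis
    by (rule fps_expansion_unique_complex[rotated])
qed

text \<open>Covers both quotients, with \<open>g = f\<close>, \<open>d = 1\<close> and with \<open>g z = f z - f (- z)\<close>, \<open>d = 2\<close>. An equation near
0 suffices for comparing power series. It needs \<open>g\<close> to have no zeros in a punctured neighbourhood of 0,
which follows from \<open>d \<noteq> 0\<close>; elsewhere in the disk a zero of \<open>g\<close> could make the equation fail.\<close>
lemma remove_sings_quotient_equation: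
  assumes f: "f \<in> class_A"
    and g: "g holomorphic_on unit_disk" "(g has_field_derivative d) (at 0)" "g 0 = 0" "d \<noteq> 0"
  shows "\<forall>\<^sub>F z in nhds 0. d * z * deriv f z = g z * remove_sings (\<lambda>z. d * z * deriv f z / g z) z"
proof -
  define h where "h z = d * z * deriv f z / g z" for z
  have "(\<lambda>z. g z / z) \<midarrow>0\<rightarrow> d"
    using g by (simp add: has_field_derivative_iff)
  then have "\<forall>\<^sub>F z in at 0. g z / z \<noteq> 0"
    using \<open>d \<noteq> 0\<close> by (rule tendsto_imp_eventually_ne)
  then have nz: "\<forall>\<^sub>F z in at 0. g z \<noteq> 0"
    by eventually_elim auto
  then obtain e where e: "e > 0" "\<And>z. z \<in> ball 0 e - {0} \<Longrightarrow> g z \<noteq> 0"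
    by (auto simp: eventually_at dist_commute)
  have "deriv f holomorphic_on unit_disk"
    using f by (intro holomorphic_deriv) (auto simp: class_A_def)
  moreover have "f holomorphic_on unit_disk"
    using f by (simp add: class_A_def)
  ultimately have "h holomorphic_on ball 0 (min e 1) - {0}"
    unfolding h_def using e(2) g(1)
    by (intro holomorphic_intros) (auto intro: holomorphic_on_subset)
  then have "isolated_singularity_at h 0"
    using e(1) by (intro isolated_singularity_at_holomorphic[of h "ball 0 (min e 1)"]) auto
  from eventually_remove_sings_eq_at[OF this] nz
  have "\<forall>\<^sub>F z in at 0. d * z * deriv f z = g z * remove_sings h z"
    by eventually_elim (simp add: h_def)
  then show ?thesis
    using g(3) unfolding h_def by (simp add: eventually_nhds_conv_at)
qed

lemma starlike_fps_equation:
  assumes f: "f \<in> class_A" and Q: "starlike_quotient f holomorphic_on unit_disk"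
  shows "fps_X * fps_deriv (fps_expansion f 0)
       = fps_expansion f 0 * fps_expansion (starlike_quotient f) 0"
proof (rule fps_expansion_unique_complex)
  have holf: "f holomorphic_on unit_disk"
    using f by (simp add: class_A_def)
  show "(\<lambda>z. z * deriv f z) has_fps_expansion fps_X * fps_deriv (fps_expansion f 0)"
    by (intro fps_expansion_intros has_fps_expansion_disk holf)
  have "\<forall>\<^sub>F z in nhds 0. 1 * z * deriv f z = f z * starlike_quotient f z"
    using remove_sings_quotient_equation[OF f holf class_A_has_deriv[OF f]] f
    by (simp add: starlike_quotient_def class_A_def)
  then have "\<forall>\<^sub>F z in nhds 0. z * deriv f z = f z * starlike_quotient f z"
    by simp
  moreover have "(\<lambda>z. f z * starlike_quotient f z) has_fps_expansion
      fps_expansion f 0 * fps_expansion (starlike_quotient f) 0"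
    by (intro fps_expansion_intros has_fps_expansion_disk holf Q)
  ultimately show "(\<lambda>z. z * deriv f z) has_fps_expansion
      fps_expansion f 0 * fps_expansion (starlike_quotient f) 0"
    by (rule iffD2[OF has_fps_expansion_cong[OF _ refl]])
qed

lemma sym_starlike_fps_equation:
  assumes f: "f \<in> class_A" and Q: "sym_starlike_quotient f holomorphic_on unit_disk"
  shows "2 * fps_X * fps_deriv (fps_expansion f 0)
       = (fps_expansion f 0 - (fps_expansion f 0 oo - fps_X)) * fps_expansion (sym_starlike_quotient f) 0"
proof (rule fps_expansion_unique_complex)
  have holf: "f holomorphic_on unit_disk"
    using f by (simp add: class_A_def)
  note F = has_fps_expansion_disk[OF holf]
  show "(\<lambda>z. 2 * z * deriv f z) has_fps_expansion 2 * fps_X * fps_deriv (fps_expansion f 0)"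
    by (intro fps_expansion_intros F)
  have "(f \<circ> (\<lambda>z. - z)) has_fps_expansion (fps_expansion f 0 oo - fps_X)"
    by (intro fps_expansion_intros F) auto
  then have G: "(\<lambda>z. f z - f (- z)) has_fps_expansion (fps_expansion f 0 - (fps_expansion f 0 oo - fps_X))"
    by (intro fps_expansion_intros F) (simp add: o_def)
  have "(f has_field_derivative 1) (at (- 0))"
    using class_A_has_deriv[OF f] by simp
  then have "((\<lambda>z. f (- z)) has_field_derivative - 1) (at 0)"
    using DERIV_chain2[OF _ DERIV_minus[OF DERIV_ident]] by fastforce
  then have "((\<lambda>z. f z - f (- z)) has_field_derivative 2) (at 0)"
    using DERIV_diff[OF class_A_has_deriv[OF f]] by fastforce
  moreover have "(f \<circ> uminus) holomorphic_on unit_disk"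
    by (intro holomorphic_on_compose_gen[OF _ holf] holomorphic_intros) auto
  then have "(\<lambda>z. f z - f (- z)) holomorphic_on unit_disk"
    by (intro holomorphic_intros holf) (simp add: o_def)
  ultimately have "\<forall>\<^sub>F z in nhds 0. 2 * z * deriv f z = (f z - f (- z)) * sym_starlike_quotient f z"
    unfolding sym_starlike_quotient_def by (intro remove_sings_quotient_equation f) auto
  moreover have "(\<lambda>z. (f z - f (- z)) * sym_starlike_quotient f z) has_fps_expansion
      (fps_expansion f 0 - (fps_expansion f 0 oo - fps_X)) * fps_expansion (sym_starlike_quotient f) 0"
    by (intro has_fps_expansion_mult G has_fps_expansion_disk Q)
  ultimately show "(\<lambda>z. 2 * z * deriv f z) has_fps_expansion
      (fps_expansion f 0 - (fps_expansion f 0 oo - fps_X)) * fps_expansion (sym_starlike_quotient f) 0"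
    by (rule iffD2[OF has_fps_expansion_cong[OF _ refl]])
qed

section \<open>Recursions for the first coefficients\<close>

lemma fps_mult_nth_le_5:
  fixes F G :: "'a :: comm_ring_1 fps"
  shows "(F * G) $ 1 = F $ 0 * G $ 1 + F $ 1 * G $ 0"
    and "(F * G) $ 2 = F $ 0 * G $ 2 + F $ 1 * G $ 1 + F $ 2 * G $ 0"
    and "(F * G) $ 3 = F $ 0 * G $ 3 + F $ 1 * G $ 2 + F $ 2 * G $ 1 + F $ 3 * G $ 0"
    and "(F * G) $ 4 = F $ 0 * G $ 4 + F $ 1 * G $ 3 + F $ 2 * G $ 2 + F $ 3 * G $ 1 + F $ 4 * G $ 0"
    and "(F * G) $ 5 = F $ 0 * G $ 5 + F $ 1 * G $ 4 + F $ 2 * G $ 3 + F $ 3 * G $ 2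
                       + F $ 4 * G $ 1 + F $ 5 * G $ 0"
  by (simp_all add: fps_mult_nth eval_nat_numeral)

lemma fps_X_mult_deriv_nth:
  fixes F :: "'a :: comm_ring_1 fps"
  shows "(fps_X * fps_deriv F) $ n = of_nat n * F $ n"
  by (cases n) simp_all

text \<open>The coefficient of \<open>X^n\<close> in \<open>X F' = F Q\<close> contains \<open>F $ n\<close> on both sides, with factors \<open>n\<close> and 1; solving
for it gives the denominator \<open>n - 1\<close>.\<close>
lemma starlike_recursion:
  fixes F Q :: "'a :: field_char_0 fps"
  assumes eq: "fps_X * fps_deriv F = F * Q" and F: "F $ 0 = 0" "F $ 1 = 1" and Q: "Q $ 0 = 1"
  shows "F $ 2 = Q $ 1"
    and "F $ 3 = (Q $ 2 + F $ 2 * Q $ 1) / 2"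
    and "F $ 4 = (Q $ 3 + F $ 2 * Q $ 2 + F $ 3 * Q $ 1) / 3"
    and "F $ 5 = (Q $ 4 + F $ 2 * Q $ 3 + F $ 3 * Q $ 2 + F $ 4 * Q $ 1) / 4"
proof -
  have "of_nat n * F $ n = (F * Q) $ n" for n
    by (metis eq fps_X_mult_deriv_nth)
  note eq = this[of 2] this[of 3] this[of 4] this[of 5]
  have "F $ 2 = Q $ 1" "2 * F $ 3 = Q $ 2 + F $ 2 * Q $ 1"
    "3 * F $ 4 = Q $ 3 + F $ 2 * Q $ 2 + F $ 3 * Q $ 1"
    "4 * F $ 5 = Q $ 4 + F $ 2 * Q $ 3 + F $ 3 * Q $ 2 + F $ 4 * Q $ 1"
    using eq F Q by (simp_all add: fps_mult_nth_le_5 algebra_simps)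
  then show "F $ 2 = Q $ 1" "F $ 3 = (Q $ 2 + F $ 2 * Q $ 1) / 2"
    "F $ 4 = (Q $ 3 + F $ 2 * Q $ 2 + F $ 3 * Q $ 1) / 3"
    "F $ 5 = (Q $ 4 + F $ 2 * Q $ 3 + F $ 3 * Q $ 2 + F $ 4 * Q $ 1) / 4"
    by (simp_all add: nonzero_eq_divide_eq mult.commute)
qed

text \<open>The series \<open>F - F(-X)\<close> keeps twice the odd coefficients of \<open>F\<close>. Hence only odd ones appear on the right,
and the denominator is \<open>n\<close> for even and \<open>n - 1\<close> for odd indices.\<close>
lemma sym_starlike_recursion:
  fixes F Q :: "'a :: field_char_0 fps"
  assumes eq: "2 * fps_X * fps_deriv F = (F - (F oo - fps_X)) * Q"
    and F: "F $ 0 = 0" "F $ 1 = 1" and Q: "Q $ 0 = 1"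
  shows "F $ 2 = Q $ 1 / 2"
    and "F $ 3 = Q $ 2 / 2"
    and "F $ 4 = (Q $ 3 + F $ 3 * Q $ 1) / 4"
    and "F $ 5 = (Q $ 4 + F $ 3 * Q $ 2) / 4"
proof -
  define G where "G = F - (F oo - fps_X)"
  have G: "G $ 0 = 0" "G $ 1 = 2" "G $ 2 = 0" "G $ 3 = 2 * F $ 3" "G $ 4 = 0" "G $ 5 = 2 * F $ 5"
    using F by (simp_all add: G_def fps_compose_uminus')
  have "fps_const 2 * (fps_X * fps_deriv F) = G * Q"
    using eq by (simp add: G_def mult.assoc numeral_fps_const)
  then have "2 * (of_nat n * F $ n) = (G * Q) $ n" for n
    by (metis fps_X_mult_deriv_nth fps_mult_left_const_nth)
  note eq = this[of 2] this[of 3] this[of 4] this[of 5]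
  have halve: "2 * a = 2 * b \<Longrightarrow> a = b" for a b :: 'a
    by simp
  have "2 * F $ 2 = Q $ 1" "2 * F $ 3 = Q $ 2"
    "4 * F $ 4 = Q $ 3 + F $ 3 * Q $ 1" "4 * F $ 5 = Q $ 4 + F $ 3 * Q $ 2"
    by (rule halve, use eq F(2) G Q in \<open>simp add: fps_mult_nth_le_5(2-5)[of G] algebra_simps\<close>)+
  then show "F $ 2 = Q $ 1 / 2" "F $ 3 = Q $ 2 / 2"
    "F $ 4 = (Q $ 3 + F $ 3 * Q $ 1) / 4" "F $ 5 = (Q $ 4 + F $ 3 * Q $ 2) / 4"
    by (simp_all add: nonzero_eq_divide_eq mult.commute)
qed

section \<open>Coefficients of the subordinate quotients\<close>

lemma moebius_coeffs:
  fixes Q W :: "'a :: field_char_0 fps"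
  assumes eq: "Q * (1 - W) = 1 + W" and W: "W $ 0 = 0"
  shows "Q $ 0 = 1"
    and "Q $ 1 = 2 * W $ 1"
    and "Q $ 2 = 2 * W $ 2 + 2 * (W $ 1)\<^sup>2"
    and "Q $ 3 = 2 * W $ 3 + 4 * W $ 1 * W $ 2 + 2 * (W $ 1)^3"
    and "Q $ 4 = 2 * W $ 4 + 4 * W $ 1 * W $ 3 + 2 * (W $ 2)\<^sup>2 + 6 * (W $ 1)\<^sup>2 * W $ 2 + 2 * (W $ 1)^4"
proof -
  have eq: "(Q * (1 - W)) $ n = (1 + W) $ n" for n
    by (simp add: eq)
  show 0: "Q $ 0 = 1"
    using eq[of 0] W by simp
  show 1: "Q $ 1 = 2 * W $ 1"
    using eq[of 1] W 0 by (simp add: fps_mult_nth_le_5 algebra_simps)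
  show 2: "Q $ 2 = 2 * W $ 2 + 2 * (W $ 1)\<^sup>2"
    using eq[of 2] W 0 1 by (simp add: fps_mult_nth_le_5 algebra_simps power2_eq_square)
  show 3: "Q $ 3 = 2 * W $ 3 + 4 * W $ 1 * W $ 2 + 2 * (W $ 1)^3"
    using eq[of 3] W 0 1 2 by (simp add: fps_mult_nth_le_5 algebra_simps power_numeral_reduce)
  show "Q $ 4 = 2 * W $ 4 + 4 * W $ 1 * W $ 3 + 2 * (W $ 2)\<^sup>2 + 6 * (W $ 1)\<^sup>2 * W $ 2 + 2 * (W $ 1)^4"
    using eq[of 4] W 0 1 2 3 by (simp add: fps_mult_nth_le_5 algebra_simps power_numeral_reduce)
qed

text \<open>The differential equation characterises \<open>Q = exp W\<close>. Multiplied by \<open>X\<close> it becomes a recursion: with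
\<open>D = X W'\<close>, the vanishing of \<open>D $ 0\<close> removes \<open>Q $ n\<close> from the coefficient of \<open>X^n\<close> in \<open>D Q\<close>.\<close>
lemma exp_coeffs:
  fixes Q W :: "'a :: field_char_0 fps"
  assumes eq: "fps_deriv Q = fps_deriv W * Q" and W: "W $ 0 = 0" and Q: "Q $ 0 = 1"
  shows "Q $ 1 = W $ 1"
    and "Q $ 2 = W $ 2 + (W $ 1)\<^sup>2 / 2"
    and "Q $ 3 = W $ 3 + W $ 1 * W $ 2 + (W $ 1)^3 / 6"
    and "Q $ 4 = W $ 4 + W $ 1 * W $ 3 + (W $ 2)\<^sup>2 / 2 + (W $ 1)\<^sup>2 * W $ 2 / 2 + (W $ 1)^4 / 24"
proof -
  define D where "D = fps_X * fps_deriv W"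
  have D: "D $ n = of_nat n * W $ n" for n
    by (simp add: D_def fps_X_mult_deriv_nth)
  have "of_nat n * Q $ n = (D * Q) $ n" for n
    by (metis D_def eq fps_X_mult_deriv_nth mult.assoc)
  then have eq: "Q $ n = (D * Q) $ n / of_nat n" if "n \<noteq> 0" for n
    using that by (simp add: nonzero_eq_divide_eq mult.commute[of "Q $ n"])
  show 1: "Q $ 1 = W $ 1"
    by (subst eq[of 1]; simp add: fps_mult_nth_le_5 D Q)
  show 2: "Q $ 2 = W $ 2 + (W $ 1)\<^sup>2 / 2"
    by (subst eq[of 2]; simp add: fps_mult_nth_le_5 1[simplified] D Q field_simps power2_eq_square)
  show 3: "Q $ 3 = W $ 3 + W $ 1 * W $ 2 + (W $ 1)^3 / 6"
    by (subst eq[of 3]; simp add: fps_mult_nth_le_5 1[simplified] 2 D Q field_simps power_numeral_reduce)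
  show "Q $ 4 = W $ 4 + W $ 1 * W $ 3 + (W $ 2)\<^sup>2 / 2 + (W $ 1)\<^sup>2 * W $ 2 / 2 + (W $ 1)^4 / 24"
    by (subst eq[of 4]; simp add: fps_mult_nth_le_5 1[simplified] 2 3 D Q field_simps power_numeral_reduce)
qed

text \<open>The equation and the value at 0 characterise \<open>Q = W + sqrt (1 + W^2)\<close>: the constant coefficient selects
the branch of the square root \<open>R = Q - W\<close>.\<close>
lemma lune_coeffs:
  fixes Q W :: "'a :: field_char_0 fps"
  assumes eq: "(Q - W) * (Q - W) = 1 + W * W" and W: "W $ 0 = 0" and Q: "Q $ 0 = 1"
  shows "Q $ 1 = W $ 1"
    and "Q $ 2 = W $ 2 + (W $ 1)\<^sup>2 / 2"
    and "Q $ 3 = W $ 3 + W $ 1 * W $ 2"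
    and "Q $ 4 = W $ 4 + W $ 1 * W $ 3 + (W $ 2)\<^sup>2 / 2 - (W $ 1)^4 / 8"
proof -
  define R where "R = Q - W"
  have eq: "(R * R) $ n = (1 + W * W) $ n" for n
    using eq by (simp add: R_def)
  have 0: "R $ 0 = 1"
    using Q W by (simp add: R_def)
  have 1: "R $ 1 = 0"
    using eq[of 1] W 0 by (simp add: fps_mult_nth_le_5)
  have 2: "R $ 2 = (W $ 1)\<^sup>2 / 2"
    using eq[of 2] W 0 1 by (simp add: fps_mult_nth_le_5 field_simps power2_eq_square)
  have 3: "R $ 3 = W $ 1 * W $ 2"
    using eq[of 3] W 0 1 2 by (simp add: fps_mult_nth_le_5 field_simps)
  have "8 * R $ 4 = 8 * W $ 1 * W $ 3 + 4 * (W $ 2)\<^sup>2 - (W $ 1)^4"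
    using eq[of 4] W 0 1 2 3 by (simp add: fps_mult_nth_le_5 field_simps power_numeral_reduce)
  then have "R $ 4 = (8 * W $ 1 * W $ 3 + 4 * (W $ 2)\<^sup>2 - (W $ 1)^4) / 8"
    by (simp add: field_simps)
  then have 4: "R $ 4 = W $ 1 * W $ 3 + (W $ 2)\<^sup>2 / 2 - (W $ 1)^4 / 8"
    by (simp add: add_divide_distrib diff_divide_distrib)
  have "Q = R + W" by (simp add: R_def)
  then show "Q $ 1 = W $ 1" "Q $ 2 = W $ 2 + (W $ 1)\<^sup>2 / 2" "Q $ 3 = W $ 3 + W $ 1 * W $ 2"
    "Q $ 4 = W $ 4 + W $ 1 * W $ 3 + (W $ 2)\<^sup>2 / 2 - (W $ 1)^4 / 8"
    using 1 2 3 4 by simp_all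
qed

section \<open>The four classes\<close>

lemma schwarz_coeffs:
  assumes "schwarz_function \<omega>" and W: "W = fps_expansion \<omega> 0"
  shows "\<omega> has_fps_expansion W"
    and "W $ 0 = 0"
    and "(norm (W $ 1))\<^sup>2 + (norm (W $ 2))\<^sup>2 + (norm (W $ 3))\<^sup>2 + (norm (W $ 4))\<^sup>2 \<le> 1"
proof -
  have hol: "\<omega> holomorphic_on unit_disk" and lt: "\<And>z. z \<in> unit_disk \<Longrightarrow> norm (\<omega> z) \<le> 1"
    and "\<omega> 0 = 0"
    using assms(1) by (auto simp: schwarz_function_def less_imp_le)
  show "\<omega> has_fps_expansion W"
    unfolding W by (rule has_fps_expansion_disk[OF hol])
  show "W $ 0 = 0"
    by (simp add: W fps_expansion_def \<open>\<omega> 0 = 0\<close>)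
  then show "(norm (W $ 1))\<^sup>2 + (norm (W $ 2))\<^sup>2 + (norm (W $ 3))\<^sup>2 + (norm (W $ 4))\<^sup>2 \<le> 1"
    using bessel_inequality_disk[OF hol lt, of 4] by (simp add: W eval_nat_numeral)
qed

lemma class_A_coeffs:
  assumes "f \<in> class_A"
  shows "fps_expansion f 0 $ 0 = 0" "fps_expansion f 0 $ 1 = 1"
  using assms by (simp_all add: class_A_def fps_expansion_def)

lemma moebius_fps_equation:
  assumes q: "q has_fps_expansion Q" and w: "\<omega> has_fps_expansion W" and \<omega>: "schwarz_function \<omega>"
    and sub: "\<And>z. z \<in> unit_disk \<Longrightarrow> q z = (1 + \<omega> z) / (1 - \<omega> z)"
  shows "Q * (1 - W) = 1 + W"
proof (rule fps_eq_of_disk_identity)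
  show "(\<lambda>z. q z * (1 - \<omega> z)) has_fps_expansion Q * (1 - W)"
    by (intro fps_expansion_intros q w)
  show "(\<lambda>z. 1 + \<omega> z) has_fps_expansion 1 + W"
    by (intro fps_expansion_intros w)
  fix z assume z: "z \<in> unit_disk"
  with \<omega> have "norm (\<omega> z) < 1"
    by (simp add: schwarz_function_def)
  then have "1 - \<omega> z \<noteq> 0"
    by auto
  then show "q z * (1 - \<omega> z) = 1 + \<omega> z"
    using sub[OF z] by simp
qed

text \<open>The leading part of the determinant here is \<open>1/2 c2 c4 - 4/9 c3^2\<close>. As in the exponential and the lune
class, the resulting quadratic in \<open>s = |c1|^2\<close> is majorised by a linear function through \<open>s - 1/4 \<le> s^2\<close>, which is
tangent to the parabola at \<open>s = 1/2\<close>.\<close>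
lemma norm_hankel_starlike_le:
  assumes "f \<in> starlike_class"
  shows "norm (third_hankel_det f) \<le> 37 / 48"
proof -
  define F where "F = fps_expansion f 0"
  define Q where "Q = fps_expansion (starlike_quotient f) 0"
  from assms have f: "f \<in> class_A" and hol: "starlike_quotient f holomorphic_on unit_disk"
    by (auto simp: starlike_class_def subordinate_def)
  from assms obtain \<omega> where \<omega>: "schwarz_function \<omega>"
    and sub: "\<And>z. z \<in> unit_disk \<Longrightarrow> starlike_quotient f z = (1 + \<omega> z) / (1 - \<omega> z)"
    by (auto simp: starlike_class_def subordinate_def)
  define W where "W = fps_expansion \<omega> 0"
  note W = schwarz_coeffs[OF \<omega> W_def]
  have Q0: "Q $ 0 = 1"
    by (simp add: Q_def fps_expansion_def starlike_quotient_0[OF f])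
  note expQ = has_fps_expansion_disk[OF hol, folded Q_def]
  have "Q * (1 - W) = 1 + W"
    by (rule moebius_fps_equation[OF expQ W(1) \<omega> sub])
  note Q = moebius_coeffs[OF this W(2)]
  note rec = starlike_recursion[OF starlike_fps_equation[OF f hol] class_A_coeffs[OF f],
    folded F_def Q_def, OF Q0]
  define w1 where "w1 = W $ 1"
  define w2 where "w2 = W $ 2"
  define w3 where "w3 = W $ 3"
  define w4 where "w4 = W $ 4"
  have a2: "F $ 2 = 2 * w1"
    unfolding rec(1) Q w1_def by simp
  have a3: "F $ 3 = 3 * w1\<^sup>2 + w2"
    unfolding rec(2) a2 Q w1_def w2_def by (simp add: field_simps power2_eq_square)
  have a4: "F $ 4 = 4 * w1^3 + 10 / 3 * w1 * w2 + 2 / 3 * w3"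
    unfolding rec(3) a2 a3 Q w1_def w2_def w3_def by (simp add: field_simps power_numeral_reduce)
  have a5: "F $ 5 = 5 * w1^4 + 43 / 6 * w1\<^sup>2 * w2 + 7 / 3 * w1 * w3 + w2\<^sup>2 + 1 / 2 * w4"
    unfolding rec(4) a2 a3 a4 Q w1_def w2_def w3_def w4_def
    by (simp add: field_simps power_numeral_reduce)
  define s where "s = (norm w1)\<^sup>2"
  have s: "0 \<le> s" "s \<le> s\<^sup>2 + 1 / 4"
    using zero_le_power2[of "s - 1 / 2"] by (simp_all add: s_def power2_diff power_divide)
  have "third_hankel_det f = 0 * w1^6 + 1 / 6 * w1^4 * w2 + 1 / 3 * w1^3 * w3 + - (11 / 18) * w1\<^sup>2 * w2\<^sup>2
      + - (1 / 2) * w1\<^sup>2 * w4 + 5 / 9 * w1 * w2 * w3 + 1 / 2 * w2 * w4 + - (4 / 9) * w3\<^sup>2"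
    unfolding third_hankel_det_expand[OF refl] taylor_coeff_def F_def[symmetric] a2 a3 a4 a5
    by (simp add: field_simps power_numeral_reduce)
  also have "norm \<dots> \<le> 37 / 48"
  proof (rule order_trans[OF norm_hankel_form_le[OF W(3)[folded w1_def w2_def w3_def w4_def]
          _ _ _ _ s_def, where K = "4 / 9" and L = "11 / 18"]], goal_cases)
    case 5
    show ?case
      using s by (simp add: norm_divide field_simps power2_eq_square)
  qed (simp_all add: norm_divide)
  finally show ?thesis .
qed

text \<open>The form reduces to four terms, with leading part \<open>1/2 c2 c4 - 1/4 c3^2\<close>, and the majorant in \<open>s\<close>
collapses to \<open>3/8 (1 - s^2)\<close>.\<close>
lemma norm_hankel_sym_starlike_le:
  assumes "f \<in> sym_starlike_class"
  shows "norm (third_hankel_det f) \<le> 3 / 8"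
proof -
  define F where "F = fps_expansion f 0"
  define Q where "Q = fps_expansion (sym_starlike_quotient f) 0"
  from assms have f: "f \<in> class_A" and hol: "sym_starlike_quotient f holomorphic_on unit_disk"
    by (auto simp: sym_starlike_class_def subordinate_def)
  from assms obtain \<omega> where \<omega>: "schwarz_function \<omega>"
    and sub: "\<And>z. z \<in> unit_disk \<Longrightarrow> sym_starlike_quotient f z = (1 + \<omega> z) / (1 - \<omega> z)"
    by (auto simp: sym_starlike_class_def subordinate_def)
  define W where "W = fps_expansion \<omega> 0"
  note W = schwarz_coeffs[OF \<omega> W_def]
  have Q0: "Q $ 0 = 1"
    by (simp add: Q_def fps_expansion_def sym_starlike_quotient_0[OF f])
  note expQ = has_fps_expansion_disk[OF hol, folded Q_def]
  have "Q * (1 - W) = 1 + W"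
    by (rule moebius_fps_equation[OF expQ W(1) \<omega> sub])
  note Q = moebius_coeffs[OF this W(2)]
  note rec = sym_starlike_recursion[OF sym_starlike_fps_equation[OF f hol] class_A_coeffs[OF f],
    folded F_def Q_def, OF Q0]
  define w1 where "w1 = W $ 1"
  define w2 where "w2 = W $ 2"
  define w3 where "w3 = W $ 3"
  define w4 where "w4 = W $ 4"
  have a2: "F $ 2 = w1"
    unfolding rec(1) Q w1_def by simp
  have a3: "F $ 3 = w1\<^sup>2 + w2"
    unfolding rec(2) a2 Q w1_def w2_def by (simp add: field_simps power2_eq_square)
  have a4: "F $ 4 = w1^3 + 3 / 2 * w1 * w2 + 1 / 2 * w3"
    unfolding rec(3) a2 a3 Q w1_def w2_def w3_def by (simp add: field_simps power_numeral_reduce)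
  have a5: "F $ 5 = w1^4 + 5 / 2 * w1\<^sup>2 * w2 + w1 * w3 + w2\<^sup>2 + 1 / 2 * w4"
    unfolding rec(4) a2 a3 a4 Q w1_def w2_def w3_def w4_def
    by (simp add: field_simps power_numeral_reduce)
  define s where "s = (norm w1)\<^sup>2"
  have s: "0 \<le> s" "s \<le> s\<^sup>2 + 1 / 4"
    using zero_le_power2[of "s - 1 / 2"] by (simp_all add: s_def power2_diff power_divide)
  have "third_hankel_det f = 0 * w1^6 + 0 * w1^4 * w2 + 0 * w1^3 * w3 + 1 / 4 * w1\<^sup>2 * w2\<^sup>2
      + 0 * w1\<^sup>2 * w4 + 1 / 2 * w1 * w2 * w3 + 1 / 2 * w2 * w4 + - (1 / 4) * w3\<^sup>2"
    unfolding third_hankel_det_expand[OF refl] taylor_coeff_def F_def[symmetric] a2 a3 a4 a5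
    by (simp add: field_simps power_numeral_reduce)
  also have "norm \<dots> \<le> 3 / 8"
  proof (rule order_trans[OF norm_hankel_form_le[OF W(3)[folded w1_def w2_def w3_def w4_def]
          _ _ _ _ s_def, where K = "1 / 4" and L = "1 / 4"]], goal_cases)
    case 5
    show ?case
      using s by (simp add: norm_divide field_simps power2_eq_square)
  qed (simp_all add: norm_divide)
  finally show ?thesis .
qed

text \<open>For the exponential and the lune class the third, fourth and fifth coefficients have the denominators 4,
36 and 72. Scaling by \<open>5184 = 72^2\<close> turns the expansion of the determinant into an identity between
polynomials with integer coefficients.\<close>
lemma hankel_clear_denominators:
  fixes a2 a3 a4 a5 :: "'a :: field_char_0"
  assumes "a3 = A3 / 4" "a4 = A4 / 36" "a5 = A5 / 72"
  shows "5184 * (a3 * (a2 * a4 - a3\<^sup>2) - a4 * (a4 - a2 * a3) + a5 * (a3 - a2\<^sup>2))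
       = 72 * a2 * A3 * A4 - 81 * A3 ^ 3 - 4 * A4\<^sup>2 + 18 * A5 * A3 - 72 * A5 * a2\<^sup>2"
  unfolding assms by (simp add: field_simps power_numeral_reduce)

text \<open>The leading part is \<open>1/8 c2 c4 - 1/9 c3^2\<close>. The equation for \<open>exp\<close> is used in the form
\<open>Q' = W' Q\<close>, so that the exponential series need not be composed with \<open>W\<close>.\<close>
lemma norm_hankel_exp_starlike_le:
  assumes "f \<in> exp_starlike_class"
  shows "norm (third_hankel_det f) \<le> 17 / 72"
proof -
  define F where "F = fps_expansion f 0"
  define Q where "Q = fps_expansion (starlike_quotient f) 0"
  from assms have f: "f \<in> class_A" and hol: "starlike_quotient f holomorphic_on unit_disk"
    by (auto simp: exp_starlike_class_def subordinate_def)
  from assms obtain \<omega> where \<omega>: "schwarz_function \<omega>"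
    and sub: "\<And>z. z \<in> unit_disk \<Longrightarrow> starlike_quotient f z = exp (\<omega> z)"
    by (auto simp: exp_starlike_class_def subordinate_def)
  define W where "W = fps_expansion \<omega> 0"
  note W = schwarz_coeffs[OF \<omega> W_def]
  have Q0: "Q $ 0 = 1"
    by (simp add: Q_def fps_expansion_def starlike_quotient_0[OF f])
  note expQ = has_fps_expansion_disk[OF hol, folded Q_def]
  have "fps_deriv Q = fps_deriv W * Q"
  proof (rule fps_eq_of_disk_identity)
    show "deriv (starlike_quotient f) has_fps_expansion fps_deriv Q"
      by (intro fps_expansion_intros expQ)
    show "(\<lambda>z. deriv \<omega> z * starlike_quotient f z) has_fps_expansion fps_deriv W * Q"
      by (intro fps_expansion_intros expQ W)
    fix z assume z: "z \<in> unit_disk"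
    have "(\<omega> has_field_derivative deriv \<omega> z) (at z)"
      using \<omega> z by (intro holomorphic_derivI[of _ unit_disk]) (auto simp: schwarz_function_def)
    then have "((\<lambda>z. exp (\<omega> z)) has_field_derivative exp (\<omega> z) * deriv \<omega> z) (at z)"
      by (rule DERIV_fun_exp)
    then have "(starlike_quotient f has_field_derivative exp (\<omega> z) * deriv \<omega> z) (at z)"
      using sub z by (elim has_field_derivative_transform_within_open[of _ _ _ unit_disk]) auto
    then show "deriv (starlike_quotient f) z = deriv \<omega> z * starlike_quotient f z"
      using sub[OF z] by (simp add: DERIV_imp_deriv)
  qed
  note Q = exp_coeffs[OF this W(2) Q0]
  note rec = starlike_recursion[OF starlike_fps_equation[OF f hol] class_A_coeffs[OF f],
    folded F_def Q_def, OF Q0]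
  define w1 where "w1 = W $ 1"
  define w2 where "w2 = W $ 2"
  define w3 where "w3 = W $ 3"
  define w4 where "w4 = W $ 4"
  have a2: "F $ 2 = w1"
    unfolding rec(1) Q w1_def by simp
  have a3: "F $ 3 = (3 * w1\<^sup>2 + 2 * w2) / 4"
    unfolding rec(2) a2 Q w1_def w2_def by (simp add: field_simps power2_eq_square)
  have a4: "F $ 4 = (17 * w1^3 + 30 * w1 * w2 + 12 * w3) / 36"
    unfolding rec(3) a2 a3 Q w1_def w2_def w3_def by (simp add: field_simps power_numeral_reduce)
  have a5: "F $ 5 = (19 * w1^4 + 60 * w1\<^sup>2 * w2 + 42 * w1 * w3 + 18 * w2\<^sup>2 + 18 * w4) / 72"
    unfolding rec(4) a2 a3 a4 Q w1_def w2_def w3_def w4_def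
    by (simp add: field_simps power_numeral_reduce)
  define s where "s = (norm w1)\<^sup>2"
  have s: "0 \<le> s" "s \<le> s\<^sup>2 + 1 / 4"
    using zero_le_power2[of "s - 1 / 2"] by (simp_all add: s_def power2_diff power_divide)
  have "5184 * third_hankel_det f = - 13 * w1^6 + 78 * w1^4 * w2 + 204 * w1^3 * w3 - 360 * w1\<^sup>2 * w2\<^sup>2
      - 324 * w1\<^sup>2 * w4 + 360 * w1 * w2 * w3 + 648 * w2 * w4 - 576 * w3\<^sup>2"
    unfolding third_hankel_det_expand[OF refl] taylor_coeff_def F_def[symmetric] a2
      hankel_clear_denominators[OF a3 a4 a5]
    by (simp add: algebra_simps power_numeral_reduce)
  also have "\<dots> = 5184 * (- (13 / 5184) * w1^6 + 13 / 864 * w1^4 * w2 + 17 / 432 * w1^3 * w3 + - (5 / 72) * w1\<^sup>2 * w2\<^sup>2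
      + - (1 / 16) * w1\<^sup>2 * w4 + 5 / 72 * w1 * w2 * w3 + 1 / 8 * w2 * w4 + - (1 / 9) * w3\<^sup>2)"
    by (simp add: algebra_simps)
  finally have "third_hankel_det f = - (13 / 5184) * w1^6 + 13 / 864 * w1^4 * w2 + 17 / 432 * w1^3 * w3 + - (5 / 72) * w1\<^sup>2 * w2\<^sup>2
      + - (1 / 16) * w1\<^sup>2 * w4 + 5 / 72 * w1 * w2 * w3 + 1 / 8 * w2 * w4 + - (1 / 9) * w3\<^sup>2"
    unfolding mult_cancel_left by simp
  also have "norm \<dots> \<le> 17 / 72"
  proof (rule order_trans[OF norm_hankel_form_le[OF W(3)[folded w1_def w2_def w3_def w4_def]
          _ _ _ _ s_def, where K = "1 / 9" and L = "5 / 72"]], goal_cases)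
    case 5
    show ?case
      using s by (simp add: norm_divide field_simps power2_eq_square)
  qed (simp_all add: norm_divide)
  finally show ?thesis .
qed

text \<open>The leading part is the one of the exponential class, since both subordinating functions begin with
\<open>1 + z + z^2/2\<close>. Squaring \<open>Q - W\<close> removes the square root.\<close>
lemma norm_hankel_lune_starlike_le:
  assumes "f \<in> lune_starlike_class"
  shows "norm (third_hankel_det f) \<le> 17 / 72"
proof -
  define F where "F = fps_expansion f 0"
  define Q where "Q = fps_expansion (starlike_quotient f) 0"
  from assms have f: "f \<in> class_A" and hol: "starlike_quotient f holomorphic_on unit_disk"
    by (auto simp: lune_starlike_class_def subordinate_def)
  from assms obtain \<omega> where \<omega>: "schwarz_function \<omega>"
    and sub: "\<And>z. z \<in> unit_disk \<Longrightarrow> starlike_quotient f z = \<omega> z + csqrt (1 + (\<omega> z)^2)"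
    by (auto simp: lune_starlike_class_def subordinate_def)
  define W where "W = fps_expansion \<omega> 0"
  note W = schwarz_coeffs[OF \<omega> W_def]
  have Q0: "Q $ 0 = 1"
    by (simp add: Q_def fps_expansion_def starlike_quotient_0[OF f])
  note expQ = has_fps_expansion_disk[OF hol, folded Q_def]
  have "(Q - W) * (Q - W) = 1 + W * W"
  proof (rule fps_eq_of_disk_identity)
    show "(\<lambda>z. (starlike_quotient f z - \<omega> z) * (starlike_quotient f z - \<omega> z))
        has_fps_expansion (Q - W) * (Q - W)"
      by (intro fps_expansion_intros expQ W)
    show "(\<lambda>z. 1 + \<omega> z * \<omega> z) has_fps_expansion 1 + W * W"
      by (intro fps_expansion_intros W)
    fix z assume z: "z \<in> unit_disk"
    show "(starlike_quotient f z - \<omega> z) * (starlike_quotient f z - \<omega> z) = 1 + \<omega> z * \<omega> z"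
      using sub[OF z] by (simp flip: power2_eq_square)
  qed
  note Q = lune_coeffs[OF this W(2) Q0]
  note rec = starlike_recursion[OF starlike_fps_equation[OF f hol] class_A_coeffs[OF f],
    folded F_def Q_def, OF Q0]
  define w1 where "w1 = W $ 1"
  define w2 where "w2 = W $ 2"
  define w3 where "w3 = W $ 3"
  define w4 where "w4 = W $ 4"
  have a2: "F $ 2 = w1"
    unfolding rec(1) Q w1_def by simp
  have a3: "F $ 3 = (3 * w1\<^sup>2 + 2 * w2) / 4"
    unfolding rec(2) a2 Q w1_def w2_def by (simp add: field_simps power2_eq_square)
  have a4: "F $ 4 = (15 * w1^3 + 30 * w1 * w2 + 12 * w3) / 36"
    unfolding rec(3) a2 a3 Q w1_def w2_def w3_def by (simp add: field_simps power_numeral_reduce)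
  have a5: "F $ 5 = (12 * w1^4 + 51 * w1\<^sup>2 * w2 + 42 * w1 * w3 + 18 * w2\<^sup>2 + 18 * w4) / 72"
    unfolding rec(4) a2 a3 a4 Q w1_def w2_def w3_def w4_def
    by (simp add: field_simps power_numeral_reduce)
  define s where "s = (norm w1)\<^sup>2"
  have s: "0 \<le> s" "s \<le> s\<^sup>2 + 1 / 4"
    using zero_le_power2[of "s - 1 / 2"] by (simp_all add: s_def power2_diff power_divide)
  have "5184 * third_hankel_det f = - 63 * w1^6 + 180 * w1^4 * w2 + 396 * w1^3 * w3 - 684 * w1\<^sup>2 * w2\<^sup>2
      - 324 * w1\<^sup>2 * w4 + 360 * w1 * w2 * w3 + 648 * w2 * w4 - 576 * w3\<^sup>2"
    unfolding third_hankel_det_expand[OF refl] taylor_coeff_def F_def[symmetric] a2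
      hankel_clear_denominators[OF a3 a4 a5]
    by (simp add: algebra_simps power_numeral_reduce)
  also have "\<dots> = 5184 * (- (7 / 576) * w1^6 + 5 / 144 * w1^4 * w2 + 11 / 144 * w1^3 * w3 + - (19 / 144) * w1\<^sup>2 * w2\<^sup>2
      + - (1 / 16) * w1\<^sup>2 * w4 + 5 / 72 * w1 * w2 * w3 + 1 / 8 * w2 * w4 + - (1 / 9) * w3\<^sup>2)"
    by (simp add: algebra_simps)
  finally have "third_hankel_det f = - (7 / 576) * w1^6 + 5 / 144 * w1^4 * w2 + 11 / 144 * w1^3 * w3 + - (19 / 144) * w1\<^sup>2 * w2\<^sup>2
      + - (1 / 16) * w1\<^sup>2 * w4 + 5 / 72 * w1 * w2 * w3 + 1 / 8 * w2 * w4 + - (1 / 9) * w3\<^sup>2"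
    unfolding mult_cancel_left by simp
  also have "norm \<dots> \<le> 17 / 72"
  proof (rule order_trans[OF norm_hankel_form_le[OF W(3)[folded w1_def w2_def w3_def w4_def]
          _ _ _ _ s_def, where K = "1 / 9" and L = "19 / 144"]], goal_cases)
    case 5
    show ?case
      using s by (simp add: norm_divide field_simps power2_eq_square)
  qed (simp_all add: norm_divide)
  finally show ?thesis .
qed

theorem theorem1:
  fixes f :: "complex \<Rightarrow> complex"
  assumes "f \<in> class_A"
  shows "(f \<in> starlike_class \<longrightarrow> norm (third_hankel_det f) \<le> 1 / 18 * (8 + bound_max))
       \<and> \<bar>1 / 18 * (8 + bound_max) - 0.777987\<bar> \<le> 0.0000005
       \<and> (f \<in> sym_starlike_class \<longrightarrow> norm (third_hankel_det f) \<le> 1 / 4 + 1 / (3 * sqrt 3))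
       \<and> 1 / 4 + 1 / (3 * sqrt 3) \<in> {0.44245..<0.44246::real}
       \<and> (f \<in> exp_starlike_class \<longrightarrow> norm (third_hankel_det f) \<le> 17 / 72)
       \<and> (f \<in> lune_starlike_class \<longrightarrow> norm (third_hankel_det f) \<le> 17 / 72)
       \<and> 17 / 72 \<in> {0.23611..<0.23612::real}"
proof (intro conjI impI)
  have "37 / 48 \<le> 1 / 18 * (8 + bound_max)"
    using bound_max_approx unfolding abs_le_iff by simp
  then show "norm (third_hankel_det f) \<le> 1 / 18 * (8 + bound_max)" if "f \<in> starlike_class"
    using norm_hankel_starlike_le[OF that] by linarith
  show "\<bar>1 / 18 * (8 + bound_max) - 0.777987\<bar> \<le> 0.0000005"
    by (rule bound_max_approx)
  show "1 / 4 + 1 / (3 * sqrt 3) \<in> {0.44245..<0.44246::real}"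
    by (rule sqrt3_numeric)
  then have "0.44245 \<le> 1 / 4 + 1 / (3 * sqrt 3 :: real)"
    unfolding atLeastLessThan_iff by blast
  then have "3 / 8 \<le> 1 / 4 + 1 / (3 * sqrt 3 :: real)"
    by (rule order_trans[rotated]) simp
  then show "norm (third_hankel_det f) \<le> 1 / 4 + 1 / (3 * sqrt 3)" if "f \<in> sym_starlike_class"
    using norm_hankel_sym_starlike_le[OF that] by linarith
  show "norm (third_hankel_det f) \<le> 17 / 72" if "f \<in> exp_starlike_class"
    by (rule norm_hankel_exp_starlike_le[OF that])
  show "norm (third_hankel_det f) \<le> 17 / 72" if "f \<in> lune_starlike_class"
    by (rule norm_hankel_lune_starlike_le[OF that])
  show "17 / 72 \<in> {0.23611..<0.23612::real}"
    by simp
qed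

end
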